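(* Let $k_1,k_2,k_3\in\mathbb{Z}_{\ge0}$ and let $(X,Y,Z)$ be a $(k_1,k_2,k_3)$-CMM triple associated with the non-labeled cluster $(a,b,c)$. Then: (1) the $(1,2)$-entry of $YZY^{-1}$ is $\frac{a^2+k_cab+b^2}{c}$ and the $(1,2)$-entry of $Y^{-1}XY$ is $\frac{b^2+k_abc+c^2}{a}$; (2) $\mathrm{tr}(YZY^{-1})=-k_c$ and $\mathrm{tr}(Y^{-1}XY)=-k_a$; (3) $YZY^{-1},\,Y^{-1}XY\in SL(2,\mathbb{Z}[x_1^{\pm1},x_2^{\pm1},x_3^{\pm1}])$. In particular, $(X,YZY^{-1},Y)$ and $(Y,Y^{-1}XY,Z)$ are $(k_1,k_2,k_3)$-CMM triples.
   Context: Fix $k_1,k_2,k_3\in\mathbb{Z}_{\ge0}$ and indeterminates $x_1,x_2,x_3$. Mutations: $\mu_1(a,b,c)=(\frac{b^2+k_1bc+c^2}{a},b,c)$, $\mu_2(a,b,c)=(a,\frac{a^2+k_2ac+c^2}{b},c)$, $\mu_3(a,b,c)=(a,b,\frac{a^2+k_3ab+b^2}{c})$. Labeled clusters of $\mathcal{A}(k_1,k_2,k_3)$: triples obtained from $(x_1,x_2,x_3)$ by finitely many mutations; non-labeled clusters: permutations of labeled clusters; cluster variables: entries of labeled clusters. A cluster variable $y$ occurs in a unique position $i$ among labeled clusters, and its parity is $k_y:=k_i$. $\mathscr{M}=\frac{x_1^2+x_2^2+x_3^2+k_1x_2x_3+k_2x_1x_3+k_3x_1x_2}{x_1x_2x_3}$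 and $T=\begin{bmatrix}-1&0\\ \mathscr{M}&-1\end{bmatrix}$. A $(k_1,k_2,k_3)$-CMM matrix is $X\in SL(2,\mathbb{Z}[x_1^{\pm1},x_2^{\pm1},x_3^{\pm1}])$ whose $(1,2)$-entry $x_{12}$ is a cluster variable and with $\mathrm{tr}(X)=-k_{x_{12}}$. A $(k_1,k_2,k_3)$-CMM triple is a triple $(X,Y,Z)$ of CMM matrices with $XYZ=T$ such that the triple of $(1,2)$-entries $(x_{12},y_{12},z_{12})$ is a non-labeled cluster; it is said to be associated with that cluster. *)

theory Defs
  imports
    "HOL-Analysis.Determinants"
    "HOL-Computational_Algebra.Polynomial_Factorial"
    "HOL-Library.Multiset"
begin

text \<open>
  The ambient field is the field of fractions of \<open>\<int>[x\<^sub>1][x\<^sub>2][x\<^sub>3]\<close>, i.e. \<open>\<rat>(x\<^sub>1, x\<^sub>2, x\<^sub>3)\<close>.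
  The innermost polynomial variable is \<open>x\<^sub>1\<close> and the outermost one is \<open>x\<^sub>3\<close>.
\<close>

type_synonym ratfun = "int poly poly poly fract"

definition x1 :: ratfun where "x1 = to_fract [:[:[:0, 1:]:]:]"
definition x2 :: ratfun where "x2 = to_fract [:[:0, 1:]:]"
definition x3 :: ratfun where "x3 = to_fract [:0, 1:]"

definition laurent :: "ratfun set" where
  "laurent = {to_fract p / (x1 ^ i * x2 ^ j * x3 ^ l) | p i j l. True}"

definition SL2_laurent :: "(ratfun ^ 2 ^ 2) set" where
  "SL2_laurent = {X. (\<forall>i j. X $ i $ j \<in> laurent) \<and> det X = 1}"

type_synonym triple = "ratfun \<times> ratfun \<times> ratfun"

definition mutation1 :: "nat \<Rightarrow> triple \<Rightarrow> triple" where
  "mutation1 k1 = (\<lambda>(a, b, c). ((b\<^sup>2 + of_nat k1 * b * c + c\<^sup>2) / a, b, c))"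

definition mutation2 :: "nat \<Rightarrow> triple \<Rightarrow> triple" where
  "mutation2 k2 = (\<lambda>(a, b, c). (a, (a\<^sup>2 + of_nat k2 * a * c + c\<^sup>2) / b, c))"

definition mutation3 :: "nat \<Rightarrow> triple \<Rightarrow> triple" where
  "mutation3 k3 = (\<lambda>(a, b, c). (a, b, (a\<^sup>2 + of_nat k3 * a * b + b\<^sup>2) / c))"

inductive_set labeled_clusters :: "nat \<Rightarrow> nat \<Rightarrow> nat \<Rightarrow> triple set"
  for k1 k2 k3 :: nat where
  initial: "(x1, x2, x3) \<in> labeled_clusters k1 k2 k3"
| mutate1: "t \<in> labeled_clusters k1 k2 k3 \<Longrightarrow> mutation1 k1 t \<in> labeled_clusters k1 k2 k3"
| mutate2: "t \<in> labeled_clusters k1 k2 k3 \<Longrightarrow> mutation2 k2 t \<in> labeled_clusters k1 k2 k3"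
| mutate3: "t \<in> labeled_clusters k1 k2 k3 \<Longrightarrow> mutation3 k3 t \<in> labeled_clusters k1 k2 k3"

text \<open>Non-labeled clusters are ordered triples; equality of multisets says that
  \<open>(a, b, c)\<close> is a permutation of \<open>(a', b', c')\<close>.\<close>

definition nonlabeled_clusters :: "nat \<Rightarrow> nat \<Rightarrow> nat \<Rightarrow> triple set" where
  "nonlabeled_clusters k1 k2 k3 =
     {(a, b, c). \<exists>(a', b', c') \<in> labeled_clusters k1 k2 k3. {#a, b, c#} = {#a', b', c'#}}"

definition entry :: "nat \<Rightarrow> 'a \<times> 'a \<times> 'a \<Rightarrow> 'a" where
  "entry i = (\<lambda>(a, b, c). if i = 1 then a else if i = 2 then b else c)"

definition cluster_variables :: "nat \<Rightarrow> nat \<Rightarrow> nat \<Rightarrow> ratfun set" where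
  "cluster_variables k1 k2 k3 =
     {entry i t | i t. i \<in> {1, 2, 3} \<and> t \<in> labeled_clusters k1 k2 k3}"

text \<open>A cluster variable occurs in exactly one of the three positions, so the
  definite description below denotes that position whenever \<open>y\<close> is a cluster variable.\<close>

definition position :: "nat \<Rightarrow> nat \<Rightarrow> nat \<Rightarrow> ratfun \<Rightarrow> nat" where
  "position k1 k2 k3 y =
     (THE i. i \<in> {1, 2, 3} \<and> (\<exists>t \<in> labeled_clusters k1 k2 k3. entry i t = y))"

definition parity :: "nat \<Rightarrow> nat \<Rightarrow> nat \<Rightarrow> ratfun \<Rightarrow> nat" where
  "parity k1 k2 k3 y = entry (position k1 k2 k3 y) (k1, k2, k3)"

definition markov_const :: "nat \<Rightarrow> nat \<Rightarrow> nat \<Rightarrow> ratfun" where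
  "markov_const k1 k2 k3 =
     (x1\<^sup>2 + x2\<^sup>2 + x3\<^sup>2 + of_nat k1 * x2 * x3 + of_nat k2 * x1 * x3 + of_nat k3 * x1 * x2)
       / (x1 * x2 * x3)"

definition T_matrix :: "nat \<Rightarrow> nat \<Rightarrow> nat \<Rightarrow> ratfun ^ 2 ^ 2" where
  "T_matrix k1 k2 k3 = vector [vector [-1, 0], vector [markov_const k1 k2 k3, -1]]"

definition CMM_matrix :: "nat \<Rightarrow> nat \<Rightarrow> nat \<Rightarrow> ratfun ^ 2 ^ 2 \<Rightarrow> bool" where
  "CMM_matrix k1 k2 k3 X \<longleftrightarrow>
     X \<in> SL2_laurent \<and>
     X $ 1 $ 2 \<in> cluster_variables k1 k2 k3 \<and>
     trace X = - of_nat (parity k1 k2 k3 (X $ 1 $ 2))"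

definition CMM_triple ::
  "nat \<Rightarrow> nat \<Rightarrow> nat \<Rightarrow> ratfun ^ 2 ^ 2 \<Rightarrow> ratfun ^ 2 ^ 2 \<Rightarrow> ratfun ^ 2 ^ 2 \<Rightarrow> bool" where
  "CMM_triple k1 k2 k3 X Y Z \<longleftrightarrow>
     CMM_matrix k1 k2 k3 X \<and> CMM_matrix k1 k2 k3 Y \<and> CMM_matrix k1 k2 k3 Z \<and>
     X ** Y ** Z = T_matrix k1 k2 k3 \<and>
     (X $ 1 $ 2, Y $ 1 $ 2, Z $ 1 $ 2) \<in> nonlabeled_clusters k1 k2 k3"

end

theory Submission imports Defs begin

text \<open>
  Positions of cluster variables are told apart in the ordered field in which
  \<open>x\<^sub>3 \<gg> x\<^sub>2 \<gg> x\<^sub>1 \<gg> 1\<close>: there cluster variables are positive, and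
  \<open>b\<^sup>2 + kbc + c\<^sup>2\<close> is, up to a bounded factor, the square of the larger of \<open>b\<close> and \<open>c\<close>.
  Hence a mutation changes a variable only by a factor that is a square up to a bounded factor,
  so that \<open>x\<^sub>i y\<close> is such an almost-square whenever \<open>y\<close> occurs in position \<open>i\<close>. A variable with
  two positions \<open>i \<noteq> j\<close> would make \<open>x\<^sub>i x\<^sub>j\<close> an almost-square, against the parity of its
  leading exponents.
  The rest is matrix algebra: \<open>XYZ = T\<close> gives \<open>(XY)\<^sub>1\<^sub>2 = c\<close> and \<open>(YZ)\<^sub>1\<^sub>2 = a\<close>, and the
  (1,2)-entries of the conjugates follow from the Markov type equation of the cluster.
\<close>

section \<open>Almost-squares in ordered rings\<close>

text \<open>For positive elements this is membership in the same Archimedean class: equality up to a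
  bounded factor, with one bound serving both directions.\<close>

definition arch_equiv :: "'a :: linordered_idom \<Rightarrow> 'a \<Rightarrow> bool" where
  "arch_equiv u v \<longleftrightarrow> (\<exists>n. u \<le> of_nat n * v \<and> v \<le> of_nat n * u)"

text \<open>The square of \<open>p / q\<close> is compared with \<open>u\<close> without division,
  so that the notion also makes sense in polynomial rings.\<close>

definition near_square :: "'a :: linordered_idom \<Rightarrow> bool" where
  "near_square u \<longleftrightarrow> (\<exists>p q. 0 < p \<and> 0 < q \<and> arch_equiv (u * q\<^sup>2) (p\<^sup>2))"

lemma arch_equiv_mult:
  assumes "arch_equiv u v" "arch_equiv u' v'" "0 < u" "0 < v" "0 < u'" "0 < v'"
  shows "arch_equiv (u * u') (v * v')"
proof -
  obtain n m where n: "u \<le> of_nat n * v" "v \<le> of_nat n * u"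
    and m: "u' \<le> of_nat m * v'" "v' \<le> of_nat m * u'"
    using assms unfolding arch_equiv_def by blast
  have "u * u' \<le> (of_nat n * v) * (of_nat m * v')"
    using n m assms by (intro mult_mono) auto
  moreover have "v * v' \<le> (of_nat n * u) * (of_nat m * u')"
    using n m assms by (intro mult_mono) auto
  ultimately show ?thesis
    unfolding arch_equiv_def by (intro exI[of _ "n * m"]) (simp add: mult_ac)
qed

lemma near_square_mult:
  assumes "near_square u" "near_square v" "0 < u" "0 < v"
  shows "near_square (u * v)"
proof -
  obtain p q p' q' where pq: "0 < p" "0 < q" "arch_equiv (u * q\<^sup>2) (p\<^sup>2)"
    "0 < p'" "0 < q'" "arch_equiv (v * q'\<^sup>2) (p'\<^sup>2)"
    using assms unfolding near_square_def by blast
  have "arch_equiv ((u * q\<^sup>2) * (v * q'\<^sup>2)) (p\<^sup>2 * p'\<^sup>2)"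
    using pq assms by (intro arch_equiv_mult) auto
  then have "arch_equiv (u * v * (q * q')\<^sup>2) ((p * p')\<^sup>2)"
    by (simp add: power_mult_distrib mult_ac)
  then show ?thesis
    unfolding near_square_def using pq mult_pos_pos by blast
qed

text \<open>The square factor is absorbed into the denominator \<open>q\<close>.\<close>

lemma near_square_cancel:
  assumes "near_square (u * v\<^sup>2)" "0 < v"
  shows "near_square u"
proof -
  obtain p q where pq: "0 < p" "0 < q" "arch_equiv (u * v\<^sup>2 * q\<^sup>2) (p\<^sup>2)"
    using assms unfolding near_square_def by blast
  then have "arch_equiv (u * (v * q)\<^sup>2) (p\<^sup>2)"
    by (simp add: power_mult_distrib mult_ac)
  then show ?thesis
    unfolding near_square_def using pq assms mult_pos_pos by blast
qed

lemma near_square_power2: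
  assumes "0 < u"
  shows "near_square (u\<^sup>2)"
  unfolding near_square_def arch_equiv_def using assms
  by (intro exI[of _ u] exI[of _ 1] conjI) auto

lemma near_square_quadratic:
  fixes b c :: "'a :: linordered_idom"
  assumes "0 < b" "0 < c"
  shows "near_square (b\<^sup>2 + of_nat k * b * c + c\<^sup>2)"
proof -
  \<comment> \<open>The square of the larger variable is the comparison value. The constant
    \<open>k + 2\<close> below adds up the bounds \<open>m^2\<close>, \<open>k * m^2\<close> and
    \<open>m^2\<close> of the three terms.\<close>
  define m where "m = max b c"
  have m: "0 < m" "b \<le> m" "c \<le> m" "m = b \<or> m = c"
    using assms by (auto simp: m_def max_def)
  have sq: "b\<^sup>2 \<le> m\<^sup>2" "c\<^sup>2 \<le> m\<^sup>2"
    using m assms by (auto intro!: power_mono)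
  have "b * c \<le> m\<^sup>2"
    unfolding power2_eq_square using m assms by (intro mult_mono) auto
  then have "of_nat k * (b * c) \<le> of_nat k * m\<^sup>2"
    by (intro mult_left_mono) auto
  with sq have up: "b\<^sup>2 + of_nat k * b * c + c\<^sup>2 \<le> of_nat (k + 2) * m\<^sup>2"
    by (simp add: algebra_simps)
  have nn: "0 \<le> of_nat k * b * c" "0 \<le> b\<^sup>2" "0 \<le> c\<^sup>2"
    using assms by auto
  then have "m\<^sup>2 \<le> 1 * (b\<^sup>2 + of_nat k * b * c + c\<^sup>2)"
    using m(4) by auto
  also have "\<dots> \<le> of_nat (k + 2) * (b\<^sup>2 + of_nat k * b * c + c\<^sup>2)"
    using nn by (intro mult_right_mono) auto
  finally have "arch_equiv ((b\<^sup>2 + of_nat k * b * c + c\<^sup>2) * 1\<^sup>2) (m\<^sup>2)"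
    using up unfolding arch_equiv_def by (intro exI[of _ "k + 2"]) simp
  then show ?thesis
    unfolding near_square_def using m(1) zero_less_one by blast
qed

section \<open>Almost-squares and leading terms of polynomials\<close>

lemma poly_pos_iff_lead_coeff: "0 < p \<longleftrightarrow> 0 < lead_coeff p" for p :: "'a :: linordered_idom poly"
  by (simp add: less_poly_def pos_poly_def)

text \<open>If \<open>q\<close> had smaller degree, \<open>p - q\<close> would inherit the positive
  leading coefficient of \<open>p\<close>.\<close>

lemma poly_le_imp_degree_le:
  fixes p q :: "'a :: linordered_idom poly"
  assumes "p \<le> q" "0 < p"
  shows "degree p \<le> degree q"
proof (rule ccontr)
  assume "\<not> degree p \<le> degree q"
  then have "lead_coeff (p - q) = lead_coeff p"
    using degree_add_eq_left[of "- q" p] by (simp add: coeff_eq_0)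
  then have "q < p"
    using assms(2) poly_pos_iff_lead_coeff[of p] poly_pos_iff_lead_coeff[of "p - q"] by simp
  with assms(1) show False
    by simp
qed

lemma poly_le_imp_lead_coeff_le:
  fixes p q :: "'a :: linordered_idom poly"
  assumes "p \<le> q" "degree p = degree q"
  shows "lead_coeff p \<le> lead_coeff q"
proof (rule ccontr)
  assume *: "\<not> lead_coeff p \<le> lead_coeff q"
  then have "0 < coeff (p - q) (degree p)"
    using assms by simp
  moreover from this have "degree p \<le> degree (p - q)"
    by (intro le_degree) simp
  then have "degree (p - q) = degree p"
    using degree_diff_le[of p "degree p" q] assms(2) by simp
  ultimately have "q < p"
    using poly_pos_iff_lead_coeff[of "p - q"] by simp
  with assms show False by simp
qed

text \<open>A nonzero natural factor leaves degrees unchanged, so the two inequalities force equal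
  degrees; the same bound then compares the leading coefficients.\<close>

lemma arch_equiv_poly:
  fixes p q :: "'a :: linordered_idom poly"
  assumes "arch_equiv p q" "0 < p" "0 < q"
  shows "degree p = degree q" "arch_equiv (lead_coeff p) (lead_coeff q)"
proof -
  obtain n where n: "p \<le> of_nat n * q" "q \<le> of_nat n * p"
    using assms unfolding arch_equiv_def by blast
  have "n \<noteq> 0"
    using n assms by (intro notI) simp
  then have deg: "degree (of_nat n * r) = degree r"
    and lc: "lead_coeff (of_nat n * r) = of_nat n * lead_coeff r" for r :: "'a poly"
    by (simp_all add: of_nat_poly)
  show eq: "degree p = degree q"
    using poly_le_imp_degree_le[OF n(1)] poly_le_imp_degree_le[OF n(2)] assms
    by (simp add: deg)
  have "lead_coeff p \<le> lead_coeff (of_nat n * q)" "lead_coeff q \<le> lead_coeff (of_nat n * p)"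
    using n eq deg by (intro poly_le_imp_lead_coeff_le; simp)+
  then show "arch_equiv (lead_coeff p) (lead_coeff q)"
    unfolding lc arch_equiv_def by blast
qed

text \<open>Comparing degrees gives deg u + 2 deg q = 2 deg p, and the leading coefficients of
  \<open>p\<close> and \<open>q\<close> are the new witnesses. Iteration peels off one variable at a
  time and reads the parity of its leading exponent.\<close>

lemma near_square_poly:
  fixes u :: "'a :: linordered_idom poly"
  assumes "near_square u" "0 < u"
  shows "even (degree u)" "near_square (lead_coeff u)"
proof -
  obtain p q where pq: "0 < p" "0 < q" "arch_equiv (u * q\<^sup>2) (p\<^sup>2)"
    using assms unfolding near_square_def by blast
  have pos: "0 < u * q\<^sup>2" "0 < p\<^sup>2"
    using pq assms by auto
  have "degree u + 2 * degree q = 2 * degree p"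
    using arch_equiv_poly(1)[OF pq(3) pos] pq assms
    by (simp add: degree_mult_eq degree_power_eq)
  then show "even (degree u)"
    by presburger
  show "near_square (lead_coeff u)"
    using arch_equiv_poly(2)[OF pq(3) pos] pq
    unfolding near_square_def poly_pos_iff_lead_coeff
    by (auto simp: lead_coeff_mult lead_coeff_power)
qed

section \<open>Descent from the fraction field\<close>

lemma to_fract_pos_iff: "0 < to_fract u \<longleftrightarrow> 0 < u" for u :: "'a :: linordered_idom"
  by (simp add: to_fract_def zero_less_Fract_iff)

lemma to_fract_le_iff: "to_fract u \<le> to_fract v \<longleftrightarrow> u \<le> v" for u v :: "'a :: linordered_idom"
  by (simp add: to_fract_def)

lemma to_fract_of_nat: "to_fract (of_nat n) = of_nat n"
  by (simp add: to_fract_def of_nat_fract)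

text \<open>With \<open>p\<close> = a/b and \<open>q\<close> = c/d, multiplying the comparison by
  \<open>(b * d)^2\<close> clears all denominators and yields the witnesses \<open>a * d\<close> and
  \<open>c * b\<close> in the ring.\<close>

lemma near_square_to_fract:
  fixes u :: "'a :: linordered_idom"
  assumes "near_square (to_fract u)"
  shows "near_square u"
proof -
  obtain p q :: "'a fract" where pq: "0 < p" "0 < q" "arch_equiv (to_fract u * q\<^sup>2) (p\<^sup>2)"
    using assms unfolding near_square_def by blast
  obtain a b where p: "p = Fract a b" "0 < b" "0 < a"
    using pq(1) by (induction p rule: fract_induct_pos) (auto simp: zero_less_Fract_iff)
  obtain c d where q: "q = Fract c d" "0 < d" "0 < c"
    using pq(2) by (induction q rule: fract_induct_pos) (auto simp: zero_less_Fract_iff)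
  obtain n where n: "to_fract u * q\<^sup>2 \<le> of_nat n * p\<^sup>2" "p\<^sup>2 \<le> of_nat n * (to_fract u * q\<^sup>2)"
    using pq unfolding arch_equiv_def by blast
  have sc: "p\<^sup>2 * to_fract ((b * d)\<^sup>2) = to_fract ((a * d)\<^sup>2)"
    "q\<^sup>2 * to_fract ((b * d)\<^sup>2) = to_fract ((c * b)\<^sup>2)"
    using p q by (simp_all add: Fract_conv_to_fract power2_eq_square)
  have pos: "0 \<le> to_fract ((b * d)\<^sup>2)"
    using p q by (intro less_imp_le) (simp add: to_fract_pos_iff del: to_fract_mult)
  have "to_fract (u * (c * b)\<^sup>2) \<le> to_fract (of_nat n * (a * d)\<^sup>2)"
    using mult_right_mono[OF n(1) pos]
    by (simp only: mult.assoc sc) (simp add: to_fract_of_nat)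
  moreover have "to_fract ((a * d)\<^sup>2) \<le> to_fract (of_nat n * (u * (c * b)\<^sup>2))"
    using mult_right_mono[OF n(2) pos]
    by (simp only: mult.assoc sc) (simp add: to_fract_of_nat)
  ultimately have "arch_equiv (u * (c * b)\<^sup>2) ((a * d)\<^sup>2)"
    unfolding arch_equiv_def to_fract_le_iff by blast
  then show ?thesis
    unfolding near_square_def using p q mult_pos_pos by blast
qed

section \<open>Cluster variables\<close>

lemma initial_pos: "0 < x1" "0 < x2" "0 < x3"
  by (simp_all add: x1_def x2_def x3_def to_fract_pos_iff poly_pos_iff_lead_coeff)

lemma not_near_square_initial:
  "\<not> near_square (x1 * x2)" "\<not> near_square (x1 * x3)" "\<not> near_square (x2 * x3)"
proof -
  show "\<not> near_square (x1 * x3)"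
  proof
    assume "near_square (x1 * x3)"
    then have "near_square ([:[:[:0, 1:]:]:] * [:0, 1:] :: int poly poly poly)"
      unfolding x1_def x3_def to_fract_mult[symmetric] by (rule near_square_to_fract)
    from near_square_poly(1)[OF this] show False
      by (simp add: poly_pos_iff_lead_coeff)
  qed
  show "\<not> near_square (x2 * x3)"
  proof
    assume "near_square (x2 * x3)"
    then have "near_square ([:[:0, 1:]:] * [:0, 1:] :: int poly poly poly)"
      unfolding x2_def x3_def to_fract_mult[symmetric] by (rule near_square_to_fract)
    from near_square_poly(1)[OF this] show False
      by (simp add: poly_pos_iff_lead_coeff)
  qed
  show "\<not> near_square (x1 * x2)"
  proof
    assume "near_square (x1 * x2)"
    then have "near_square ([:[:[:0, 1:]:]:] * [:[:0, 1:]:] :: int poly poly poly)"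
      unfolding x1_def x2_def to_fract_mult[symmetric] by (rule near_square_to_fract)
    \<comment> \<open>This product is constant in \<open>x3\<close>, so its degree there is even;
      the obstruction is the odd degree of its leading coefficient in \<open>x2\<close>.\<close>
    from near_square_poly(2)[OF this]
    have "near_square ([:[:0, 1:]:] * [:0, 1:] :: int poly poly)"
      by (simp add: poly_pos_iff_lead_coeff)
    from near_square_poly(1)[OF this] show False
      by (simp add: poly_pos_iff_lead_coeff)
  qed
qed

text \<open>Multiplying \<open>x * a\<close> by the numerator, itself an almost-square, gives
  \<open>x\<close> times the new variable times \<open>a^2\<close>, and the square cancels.\<close>

lemma near_square_exchange:
  fixes a b c :: "'a :: linordered_field"
  assumes "near_square (x * a)" "0 < x" "0 < a" "0 < b" "0 < c"
  shows "0 < (b\<^sup>2 + of_nat k * b * c + c\<^sup>2) / a"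
    "near_square (x * ((b\<^sup>2 + of_nat k * b * c + c\<^sup>2) / a))"
proof -
  let ?B = "b\<^sup>2 + of_nat k * b * c + c\<^sup>2"
  have "0 < ?B"
    using assms by (intro add_pos_pos add_pos_nonneg) auto
  then show "0 < ?B / a"
    using assms by simp
  have "near_square (x * a * ?B)"
    using assms \<open>0 < ?B\<close> by (intro near_square_mult[OF assms(1) near_square_quadratic]) auto
  also have "x * a * ?B = x * (?B / a) * a\<^sup>2"
    using assms by (simp add: power2_eq_square)
  finally show "near_square (x * (?B / a))"
    using assms(3) by (rule near_square_cancel)
qed

text \<open>Positivity is carried along because the product and exchange rules for almost-squares
  require it.\<close>

lemma labeled_cluster_invariant:
  assumes "t \<in> labeled_clusters k1 k2 k3"
  shows "case t of (a, b, c) \<Rightarrow> 0 < a \<and> 0 < b \<and> 0 < c \<and>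
    near_square (x1 * a) \<and> near_square (x2 * b) \<and> near_square (x3 * c)"
  using assms
proof induction
  case initial
  then show ?case
    using initial_pos by (simp add: near_square_power2 flip: power2_eq_square)
next
  case (mutate1 t)
  then show ?case
    using initial_pos near_square_exchange[of x1] by (auto simp: mutation1_def split: prod.splits)
next
  case (mutate2 t)
  then show ?case
    using initial_pos near_square_exchange[of x2] by (auto simp: mutation2_def split: prod.splits)
next
  case (mutate3 t)
  then show ?case
    using initial_pos near_square_exchange[of x3] by (auto simp: mutation3_def split: prod.splits)
qed

lemma position_entry:
  assumes t: "t \<in> labeled_clusters k1 k2 k3" and i: "i \<in> {1, 2, 3}"
  shows "position k1 k2 k3 (entry i t) = i"
  unfolding position_def
proof (rule the_equality)
  show "i \<in> {1, 2, 3} \<and> (\<exists>s\<in>labeled_clusters k1 k2 k3. entry i s = entry i t)"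
    using assms by blast
next
  define y where "y = entry i t"
  have inv: "0 < entry l s" "near_square (entry l (x1, x2, x3) * entry l s)"
    if "s \<in> labeled_clusters k1 k2 k3" for l s
    using labeled_cluster_invariant[OF that] by (auto simp: entry_def split: prod.splits)
  fix j assume "j \<in> {1, 2, 3} \<and> (\<exists>s\<in>labeled_clusters k1 k2 k3. entry j s = entry i t)"
  then obtain s where j: "j \<in> {1, 2, 3}" and s: "s \<in> labeled_clusters k1 k2 k3" "entry j s = y"
    unfolding y_def by blast
  have y: "0 < y"
    unfolding y_def using inv t by blast
  let ?x = "\<lambda>l. entry l (x1, x2, x3)"
  have "0 < ?x l" for l
    using initial_pos by (simp add: entry_def)
  \<comment> \<open>The invariant is applied to the same \<open>y\<close> in both positions;
    cancelling \<open>y^2\<close> leaves the product of two initial variables, which is an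
    almost-square only if \<open>i = j\<close>.\<close>
  then have "near_square ((?x i * y) * (?x j * y))"
    using inv(2)[OF t, of i] inv(2)[OF s(1), of j] y s(2)
    by (intro near_square_mult[of "?x i * y" "?x j * y"]) (auto simp: y_def)
  then have "near_square (?x i * ?x j * y\<^sup>2)"
    by (simp add: power2_eq_square mult_ac)
  then have "near_square (?x i * ?x j)"
    using y by (rule near_square_cancel)
  with i j not_near_square_initial show "j = i"
    by (auto simp: entry_def mult.commute)
qed

lemma parity_entry:
  assumes "t \<in> labeled_clusters k1 k2 k3" "i \<in> {1, 2, 3}"
  shows "parity k1 k2 k3 (entry i t) = entry i (k1, k2, k3)"
  using position_entry[OF assms] by (simp add: parity_def)

section \<open>The Markov-type equation of a cluster\<close>

definition markov_eq :: "nat \<Rightarrow> nat \<Rightarrow> nat \<Rightarrow> 'a \<Rightarrow> 'a :: field \<Rightarrow> 'a \<Rightarrow> 'a \<Rightarrow> bool" where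
  "markov_eq ka kb kc M a b c \<longleftrightarrow>
     a\<^sup>2 + b\<^sup>2 + c\<^sup>2 + of_nat ka * b * c + of_nat kb * a * c + of_nat kc * a * b = M * a * b * c"

text \<open>Each parity travels with its variable. The two adjacent swaps generate all permutations,
  so only exchange of the last variable has to be computed.\<close>

lemma markov_eq_swap12: "markov_eq ka kb kc M a b c \<Longrightarrow> markov_eq kb ka kc M b a c"
  and markov_eq_swap23: "markov_eq ka kb kc M a b c \<Longrightarrow> markov_eq ka kc kb M a c b"
  by (simp_all add: markov_eq_def algebra_simps)

text \<open>Both \<open>c\<close> and \<open>c'\<close> are roots of the Markov equation read as a quadratic in its last variable.\<close>

lemma markov_eq_exchange:
  assumes "markov_eq ka kb kc M a b c" "c \<noteq> 0"
  shows "markov_eq ka kb kc M a b ((a\<^sup>2 + of_nat kc * a * b + b\<^sup>2) / c)"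
proof -
  define c' where "c' = (a\<^sup>2 + of_nat kc * a * b + b\<^sup>2) / c"
  have prod: "c * c' = a\<^sup>2 + of_nat kc * a * b + b\<^sup>2"
    using assms by (simp add: c'_def)
  \<comment> \<open>Replacing the terms free of \<open>c\<close> by \<open>c * c'\<close> makes
    every term of the equation divisible by \<open>c\<close>; cancelling it gives the Vieta formula
    for the sum of the roots.\<close>
  have "c * (c' + c + of_nat ka * b + of_nat kb * a) = c * (M * a * b)"
    using assms(1) unfolding markov_eq_def by (simp add: distrib_left prod power2_eq_square mult_ac)
      (simp add: algebra_simps)
  then have sum: "M * a * b = c' + c + of_nat ka * b + of_nat kb * a"
    using assms(2) by simp
  show ?thesis
    unfolding markov_eq_def c'_def[symmetric] sum
    using prod by (simp add: algebra_simps power2_eq_square)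
qed

lemma markov_eq_labeled:
  assumes "t \<in> labeled_clusters k1 k2 k3"
  shows "case t of (a, b, c) \<Rightarrow> markov_eq k1 k2 k3 (markov_const k1 k2 k3) a b c"
  using assms
proof induction
  case initial
  then show ?case
    using initial_pos by (simp add: markov_eq_def markov_const_def)
next
  case (mutate1 t)
  obtain a b c where t: "t = (a, b, c)"
    by (cases t)
  \<comment> \<open>The mutated entry is rotated to the last place for the exchange and rotated back
    afterwards.\<close>
  have "a \<noteq> 0" "markov_eq k2 k3 k1 (markov_const k1 k2 k3) b c a"
    using labeled_cluster_invariant[OF mutate1.hyps] mutate1.IH t
      markov_eq_swap12 markov_eq_swap23 by fastforce+
  from markov_eq_exchange[OF this(2,1)] show ?case
    using t markov_eq_swap12 markov_eq_swap23 by (fastforce simp: mutation1_def)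
next
  case (mutate2 t)
  obtain a b c where t: "t = (a, b, c)"
    by (cases t)
  have "b \<noteq> 0" "markov_eq k1 k3 k2 (markov_const k1 k2 k3) a c b"
    using labeled_cluster_invariant[OF mutate2.hyps] mutate2.IH t
      markov_eq_swap23 by fastforce+
  from markov_eq_exchange[OF this(2,1)] show ?case
    using t markov_eq_swap23 by (fastforce simp: mutation2_def)
next
  case (mutate3 t)
  obtain a b c where t: "t = (a, b, c)"
    by (cases t)
  have "c \<noteq> 0" "markov_eq k1 k2 k3 (markov_const k1 k2 k3) a b c"
    using labeled_cluster_invariant[OF mutate3.hyps] mutate3.IH t by fastforce+
  from markov_eq_exchange[OF this(2,1)] show ?case
    using t by (simp add: mutation3_def)
qed

section \<open>Exchange in non-labeled clusters\<close>

lemma mset3_eqD: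
  assumes "{#a, b, c#} = {#a', b', c'#}"
  shows "(a, b, c) \<in> {(a', b', c'), (a', c', b'), (b', a', c'), (b', c', a'), (c', a', b'), (c', b', a')}"
  using assms by (auto simp: add_eq_conv_ex)

lemma nonlabeled_cluster_swap12:
    "(a, b, c) \<in> nonlabeled_clusters k1 k2 k3 \<Longrightarrow> (b, a, c) \<in> nonlabeled_clusters k1 k2 k3"
  and nonlabeled_cluster_swap23:
    "(a, b, c) \<in> nonlabeled_clusters k1 k2 k3 \<Longrightarrow> (a, c, b) \<in> nonlabeled_clusters k1 k2 k3"
  by (simp_all add: nonlabeled_clusters_def add_mset_commute)

lemma nonlabeled_clusterI:
  assumes "(a', b', c') \<in> labeled_clusters k1 k2 k3" "{#a, b, c#} = {#a', b', c'#}"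
  shows "(a, b, c) \<in> nonlabeled_clusters k1 k2 k3"
  unfolding nonlabeled_clusters_def using assms by blast

lemma labeled_cluster_facts:
  assumes "(a, b, c) \<in> labeled_clusters k1 k2 k3"
  shows "a \<noteq> 0" "b \<noteq> 0" "c \<noteq> 0"
    "parity k1 k2 k3 a = k1" "parity k1 k2 k3 b = k2" "parity k1 k2 k3 c = k3"
    "a \<in> cluster_variables k1 k2 k3" "b \<in> cluster_variables k1 k2 k3"
    "c \<in> cluster_variables k1 k2 k3"
proof -
  show "a \<noteq> 0" "b \<noteq> 0" "c \<noteq> 0"
    using labeled_cluster_invariant[OF assms] by auto
  show "parity k1 k2 k3 a = k1" "parity k1 k2 k3 b = k2" "parity k1 k2 k3 c = k3"
    using parity_entry[OF assms, of 1] parity_entry[OF assms, of 2] parity_entry[OF assms, of 3]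
    by (simp_all add: entry_def)
  have "entry i (a, b, c) \<in> cluster_variables k1 k2 k3" if "i \<in> {1, 2, 3}" for i
    using assms that unfolding cluster_variables_def by blast
  from this[of 1] this[of 2] this[of 3]
  show "a \<in> cluster_variables k1 k2 k3" "b \<in> cluster_variables k1 k2 k3"
    "c \<in> cluster_variables k1 k2 k3"
    by (simp_all add: entry_def)
qed

text \<open>The mutation is performed at the labeled position of \<open>c\<close>. The new variable
  occupies that same position, which is why its parity is unchanged. Permuting the triple first
  makes the lemma available for every entry.\<close>

lemma nonlabeled_cluster_exchange:
  assumes "(a, b, c) \<in> nonlabeled_clusters k1 k2 k3"
  defines "par \<equiv> parity k1 k2 k3"
  defines "c' \<equiv> (a\<^sup>2 + of_nat (par c) * a * b + b\<^sup>2) / c"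
  shows "c \<noteq> 0"
    and "markov_eq (par a) (par b) (par c) (markov_const k1 k2 k3) a b c"
    and "(a, b, c') \<in> nonlabeled_clusters k1 k2 k3"
    and "c' \<in> cluster_variables k1 k2 k3"
    and "par c' = par c"
proof -
  let ?L = "labeled_clusters k1 k2 k3"
  obtain u v w where uvw: "(u, v, w) \<in> ?L" and eq: "{#a, b, c#} = {#u, v, w#}"
    using assms(1) unfolding nonlabeled_clusters_def by auto
  note facts = labeled_cluster_facts[OF uvw]
  note perm = mset3_eqD[OF eq]
  have meq: "markov_eq k1 k2 k3 (markov_const k1 k2 k3) u v w"
    using markov_eq_labeled[OF uvw] by simp
  have par: "par u = k1" "par v = k2" "par w = k3"
    using facts by (simp_all add: par_def)
  show "c \<noteq> 0"
    using perm facts by auto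
  show "markov_eq (par a) (par b) (par c) (markov_const k1 k2 k3) a b c"
    \<comment> \<open>The identity and these compositions of swaps cover all six orders of the
      labeled cluster.\<close>
    using perm par meq markov_eq_swap12[OF meq] markov_eq_swap23[OF meq]
      markov_eq_swap23[OF markov_eq_swap12[OF meq]] markov_eq_swap12[OF markov_eq_swap23[OF meq]]
      markov_eq_swap12[OF markov_eq_swap23[OF markov_eq_swap12[OF meq]]]
    by auto
  \<comment> \<open>Only the position of \<open>c\<close> matters: the exchange formula is symmetric
    in the other two variables.\<close>
  consider "c = u" "{#a, b#} = {#v, w#}" | "c = v" "{#a, b#} = {#u, w#}"
    | "c = w" "{#a, b#} = {#u, v#}"
    using perm by (elim insertE) (force simp: add_mset_commute)+
  then have "(a, b, c') \<in> nonlabeled_clusters k1 k2 k3 \<and>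
    c' \<in> cluster_variables k1 k2 k3 \<and> par c' = par c"
  proof cases
    case 1
    have "c' = (v\<^sup>2 + of_nat k1 * v * w + w\<^sup>2) / u"
      using 1 par unfolding c'_def by (auto simp: add_eq_conv_ex algebra_simps)
    then have L: "(c', v, w) \<in> ?L"
      using labeled_clusters.mutate1[OF uvw] by (simp add: mutation1_def)
    moreover have "{#a, b, c'#} = {#c', v, w#}"
      using 1 by (metis add_mset_commute)
    ultimately have "(a, b, c') \<in> nonlabeled_clusters k1 k2 k3"
      by (rule nonlabeled_clusterI)
    then show ?thesis
      using labeled_cluster_facts[OF L] 1(1) par unfolding par_def by simp
  next
    case 2
    have "c' = (u\<^sup>2 + of_nat k2 * u * w + w\<^sup>2) / v"
      using 2 par unfolding c'_def by (auto simp: add_eq_conv_ex algebra_simps)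
    then have L: "(u, c', w) \<in> ?L"
      using labeled_clusters.mutate2[OF uvw] by (simp add: mutation2_def)
    moreover have "{#a, b, c'#} = {#u, c', w#}"
      using 2 by (metis add_mset_commute)
    ultimately have "(a, b, c') \<in> nonlabeled_clusters k1 k2 k3"
      by (rule nonlabeled_clusterI)
    then show ?thesis
      using labeled_cluster_facts[OF L] 2(1) par unfolding par_def by simp
  next
    case 3
    have "c' = (u\<^sup>2 + of_nat k3 * u * v + v\<^sup>2) / w"
      using 3 par unfolding c'_def by (auto simp: add_eq_conv_ex algebra_simps)
    then have L: "(u, v, c') \<in> ?L"
      using labeled_clusters.mutate3[OF uvw] by (simp add: mutation3_def)
    moreover have "{#a, b, c'#} = {#u, v, c'#}"
      using 3 by (metis add_mset_commute)
    ultimately have "(a, b, c') \<in> nonlabeled_clusters k1 k2 k3"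
      by (rule nonlabeled_clusterI)
    then show ?thesis
      using labeled_cluster_facts[OF L] 3(1) par unfolding par_def by simp
  qed
  then show "(a, b, c') \<in> nonlabeled_clusters k1 k2 k3"
    "c' \<in> cluster_variables k1 k2 k3" "par c' = par c"
    by auto
qed

section \<open>Matrices over the Laurent polynomial ring\<close>

lemma laurent_add:
  assumes "u \<in> laurent" "v \<in> laurent"
  shows "u + v \<in> laurent"
proof -
  obtain p i j l q i' j' l' where
    u: "u = to_fract p / (x1 ^ i * x2 ^ j * x3 ^ l)" and
    v: "v = to_fract q / (x1 ^ i' * x2 ^ j' * x3 ^ l')"
    using assms unfolding laurent_def by auto
  \<comment> \<open>Monomials are kept as polynomials, so that the numerator over the common
    denominator is visibly the image of a polynomial.\<close>
  define m :: "nat \<Rightarrow> nat \<Rightarrow> nat \<Rightarrow> int poly poly poly"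
    where "m i j l = [:[:[:0, 1:]:]:] ^ i * [:[:0, 1:]:] ^ j * [:0, 1:] ^ l" for i j l
  have pow: "to_fract (r ^ n) = to_fract r ^ n" for r :: "int poly poly poly" and n
    by (induction n) auto
  have m: "to_fract (m i j l) = x1 ^ i * x2 ^ j * x3 ^ l" for i j l
    by (simp add: m_def x1_def x2_def x3_def pow)
  have "u + v = to_fract (p * m i' j' l' + q * m i j l) / (x1 ^ (i + i') * x2 ^ (j + j') * x3 ^ (l + l'))"
    unfolding u v using initial_pos by (simp add: m field_simps power_add)
  then show ?thesis
    unfolding laurent_def by blast
qed

lemma laurent_mult:
  assumes "u \<in> laurent" "v \<in> laurent"
  shows "u * v \<in> laurent"
proof -
  obtain p i j l q i' j' l' where
    u: "u = to_fract p / (x1 ^ i * x2 ^ j * x3 ^ l)" and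
    v: "v = to_fract q / (x1 ^ i' * x2 ^ j' * x3 ^ l')"
    using assms unfolding laurent_def by auto
  have "u * v = to_fract (p * q) / (x1 ^ (i + i') * x2 ^ (j + j') * x3 ^ (l + l'))"
    unfolding u v by (simp add: power_add mult_ac)
  then show ?thesis
    unfolding laurent_def by blast
qed

lemma laurent_uminus: "u \<in> laurent \<Longrightarrow> - u \<in> laurent"
  unfolding laurent_def by (auto simp: minus_divide_left simp flip: to_fract_uminus) blast

section \<open>Two by two matrices of determinant one\<close>

lemma matrix_matrix_mult_2:
  fixes A B :: "'a :: comm_ring_1 ^ 2 ^ 2"
  shows "(A ** B) $ i $ j = A $ i $ 1 * B $ 1 $ j + A $ i $ 2 * B $ 2 $ j"
  by (simp add: matrix_matrix_mult_def sum_2)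

lemma trace_2: "trace (A :: 'a :: comm_ring_1 ^ 2 ^ 2) = A $ 1 $ 1 + A $ 2 $ 2"
  by (simp add: trace_def sum_2)

text \<open>The adjugate is a two-sided inverse. It shows that the choice behind
  \<open>matrix_inv\<close> succeeds, and uniqueness of inverses identifies the two.\<close>

lemma matrix_inv_2:
  fixes A :: "'a :: field ^ 2 ^ 2"
  assumes "det A = 1"
  shows "A ** matrix_inv A = mat 1" "matrix_inv A ** A = mat 1"
    "matrix_inv A $ 1 $ 1 = A $ 2 $ 2" "matrix_inv A $ 1 $ 2 = - A $ 1 $ 2"
    "matrix_inv A $ 2 $ 1 = - A $ 2 $ 1" "matrix_inv A $ 2 $ 2 = A $ 1 $ 1"
proof -
  define B :: "'a ^ 2 ^ 2"
    where "B = vector [vector [A $ 2 $ 2, - A $ 1 $ 2], vector [- A $ 2 $ 1, A $ 1 $ 1]]"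
  have B: "B $ 1 $ 1 = A $ 2 $ 2" "B $ 1 $ 2 = - A $ 1 $ 2"
    "B $ 2 $ 1 = - A $ 2 $ 1" "B $ 2 $ 2 = A $ 1 $ 1"
    by (simp_all add: B_def)
  have det: "A $ 1 $ 1 * A $ 2 $ 2 - A $ 1 $ 2 * A $ 2 $ 1 = 1"
    using assms by (simp add: det_2)
  have "A ** B = mat 1" "B ** A = mat 1"
    using det by (simp_all add: vec_eq_iff forall_2 matrix_matrix_mult_2 B mat_def algebra_simps)
  moreover from this have "\<exists>C. A ** C = mat 1 \<and> C ** A = mat 1"
    by blast
  then have inv: "A ** matrix_inv A = mat 1 \<and> matrix_inv A ** A = mat 1"
    unfolding matrix_inv_def by (rule someI_ex)
  ultimately have "matrix_inv A = B"
    by (metis matrix_mul_assoc matrix_mul_lid)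
  with inv show "A ** matrix_inv A = mat 1" "matrix_inv A ** A = mat 1"
    "matrix_inv A $ 1 $ 1 = A $ 2 $ 2" "matrix_inv A $ 1 $ 2 = - A $ 1 $ 2"
    "matrix_inv A $ 2 $ 1 = - A $ 2 $ 1" "matrix_inv A $ 2 $ 2 = A $ 1 $ 1"
    using B by auto
qed

lemma SL2_laurent_mult:
  assumes "A \<in> SL2_laurent" "B \<in> SL2_laurent"
  shows "A ** B \<in> SL2_laurent"
  using assms unfolding SL2_laurent_def
  by (auto simp: det_mul matrix_matrix_mult_2 intro!: laurent_add laurent_mult)

lemma SL2_laurent_inv:
  assumes "A \<in> SL2_laurent"
  shows "matrix_inv A \<in> SL2_laurent"
proof -
  have det: "det A = 1"
    using assms by (simp add: SL2_laurent_def)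
  show ?thesis
    using assms unfolding SL2_laurent_def
    by (auto simp: forall_2 matrix_inv_2[OF det] det_2 mult_ac intro: laurent_uminus)
qed

section \<open>Conjugation of the matrices of a triple\<close>

theorem theorem5p6:
  fixes k1 k2 k3 :: nat and X Y Z :: "ratfun ^ 2 ^ 2" and a b c :: ratfun
  assumes "CMM_triple k1 k2 k3 X Y Z"
    and "(X $ 1 $ 2, Y $ 1 $ 2, Z $ 1 $ 2) = (a, b, c)"
  shows "(Y ** Z ** matrix_inv Y) $ 1 $ 2
           = (a\<^sup>2 + of_nat (parity k1 k2 k3 c) * a * b + b\<^sup>2) / c \<and>
    (matrix_inv Y ** X ** Y) $ 1 $ 2
           = (b\<^sup>2 + of_nat (parity k1 k2 k3 a) * b * c + c\<^sup>2) / a \<and>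
    trace (Y ** Z ** matrix_inv Y) = - of_nat (parity k1 k2 k3 c) \<and>
    trace (matrix_inv Y ** X ** Y) = - of_nat (parity k1 k2 k3 a) \<and>
    Y ** Z ** matrix_inv Y \<in> SL2_laurent \<and>
    matrix_inv Y ** X ** Y \<in> SL2_laurent \<and>
    CMM_triple k1 k2 k3 X (Y ** Z ** matrix_inv Y) Y \<and>
    CMM_triple k1 k2 k3 Y (matrix_inv Y ** X ** Y) Z"
proof -
  define M where "M = markov_const k1 k2 k3"
  define T where "T = T_matrix k1 k2 k3"
  define U where "U = Y ** Z ** matrix_inv Y"
  define V where "V = matrix_inv Y ** X ** Y"
  define ka kb kc where k: "ka = parity k1 k2 k3 a" "kb = parity k1 k2 k3 b"
    "kc = parity k1 k2 k3 c"
  have abc: "X $ 1 $ 2 = a" "Y $ 1 $ 2 = b" "Z $ 1 $ 2 = c"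
    using assms(2) by auto
  have cl: "(a, b, c) \<in> nonlabeled_clusters k1 k2 k3"
    and CMM: "CMM_matrix k1 k2 k3 X" "CMM_matrix k1 k2 k3 Y" "CMM_matrix k1 k2 k3 Z"
    and XYZ: "X ** Y ** Z = T"
    using assms by (auto simp: CMM_triple_def T_def)
  \<comment> \<open>The rotation puts \<open>a\<close> last, so that the exchange lemma also applies
    to \<open>a\<close>. In \<open>ex\<close>, facts 1 to 5 concern \<open>c\<close> and facts 6 to
    10 concern \<open>a\<close>.\<close>
  have cl': "(b, c, a) \<in> nonlabeled_clusters k1 k2 k3"
    using cl nonlabeled_cluster_swap12 nonlabeled_cluster_swap23 by blast
  have SL: "X \<in> SL2_laurent" "Y \<in> SL2_laurent" "Z \<in> SL2_laurent"
    using CMM by (auto simp: CMM_matrix_def)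
  then have det: "det X = 1" "det Y = 1" "det Z = 1"
    by (auto simp: SL2_laurent_def)
  have tr: "X $ 1 $ 1 + X $ 2 $ 2 = - of_nat ka" "Y $ 1 $ 1 + Y $ 2 $ 2 = - of_nat kb"
    "Z $ 1 $ 1 + Z $ 2 $ 2 = - of_nat kc"
    using CMM abc by (auto simp: CMM_matrix_def trace_2 k)
  have T: "T $ 1 $ 1 = -1" "T $ 1 $ 2 = 0" "T $ 2 $ 1 = M" "T $ 2 $ 2 = -1"
    by (simp_all add: T_def T_matrix_def M_def)
  have YZ: "Y ** Z = matrix_inv X ** T"
    by (metis XYZ matrix_inv_2(2)[OF det(1)] matrix_mul_assoc matrix_mul_lid)
  have XY: "X ** Y = T ** matrix_inv Z"
    by (metis XYZ matrix_inv_2(1)[OF det(3)] matrix_mul_assoc matrix_mul_rid)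
  note ex = nonlabeled_cluster_exchange[OF cl] nonlabeled_cluster_exchange[OF cl']
  have meq: "a\<^sup>2 + b\<^sup>2 + c\<^sup>2 + of_nat ka * b * c + of_nat kb * a * c + of_nat kc * a * b = M * a * b * c"
    using ex(2) by (simp add: markov_eq_def k M_def)
  \<comment> \<open>The second column of \<open>T\<close> is (0, -1), so the entry of
    \<open>matrix_inv X ** T\<close> is \<open>a\<close>; dually, the first row (-1, 0) of
    \<open>T\<close> gives \<open>c\<close> below.\<close>
  have YZ12: "Y $ 1 $ 1 * c + b * Z $ 2 $ 2 = a"
    using arg_cong[OF YZ, of "\<lambda>A. A $ 1 $ 2"]
    by (simp add: matrix_matrix_mult_2 matrix_inv_2[OF det(1)] T abc)
  have XY12: "X $ 1 $ 1 * b + a * Y $ 2 $ 2 = c"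
    using arg_cong[OF XY, of "\<lambda>A. A $ 1 $ 2"]
    by (simp add: matrix_matrix_mult_2 matrix_inv_2[OF det(3)] T abc)
  have U12: "U $ 1 $ 2 = (a\<^sup>2 + of_nat kc * a * b + b\<^sup>2) / c"
  proof -
    have "U $ 1 $ 2 = (X $ 2 $ 2 + a * M) * b + a * Y $ 1 $ 1"
      unfolding U_def YZ
      by (simp add: matrix_matrix_mult_2 matrix_inv_2[OF det(1)] matrix_inv_2[OF det(2)] T abc
          algebra_simps)
    \<comment> \<open>The traces trade \<open>X $ 2 $ 2\<close> and \<open>Y $ 1 $ 1\<close> for the
      opposite diagonal entries; the bracket is then \<open>c\<close> by \<open>XY12\<close>,
      leaving the other root of the quadratic.\<close>
    also have "\<dots> = M * a * b - of_nat ka * b - of_nat kb * a - (X $ 1 $ 1 * b + a * Y $ 2 $ 2)"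
      using tr by algebra
    \<comment> \<open>After multiplication by \<open>c\<close> this is the Markov equation
      rearranged.\<close>
    also have "\<dots> * c = a\<^sup>2 + of_nat kc * a * b + b\<^sup>2"
      unfolding XY12 using meq by algebra
    finally show ?thesis
      using ex(1) by (simp add: field_simps)
  qed
  have V12: "V $ 1 $ 2 = (b\<^sup>2 + of_nat ka * b * c + c\<^sup>2) / a"
  proof -
    \<comment> \<open>The mirror computation, with \<open>V\<close> read as
      \<open>matrix_inv Y ** T ** matrix_inv Z\<close>.\<close>
    have "V $ 1 $ 2 = Y $ 2 $ 2 * c + b * (M * c + Z $ 1 $ 1)"
      unfolding V_def matrix_mul_assoc[symmetric] XY
      by (simp add: matrix_matrix_mult_2 matrix_inv_2[OF det(3)] matrix_inv_2[OF det(2)] T abc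
          algebra_simps)
    also have "\<dots> = M * b * c - of_nat kb * c - of_nat kc * b - (Y $ 1 $ 1 * c + b * Z $ 2 $ 2)"
      using tr by algebra
    also have "\<dots> * a = b\<^sup>2 + of_nat ka * b * c + c\<^sup>2"
      unfolding YZ12 using meq by algebra
    finally show ?thesis
      using ex(6) by (simp add: field_simps)
  qed
  \<comment> \<open>Cyclicity of the trace cancels \<open>Y\<close> against its inverse.\<close>
  have trU: "trace U = - of_nat kc"
    unfolding U_def using CMM(3) abc
    by (subst trace_mul_sym)
      (simp add: matrix_mul_assoc matrix_inv_2[OF det(2)] CMM_matrix_def k)
  have trV: "trace V = - of_nat ka"
    unfolding V_def matrix_mul_assoc[symmetric] using CMM(1) abc
    by (subst trace_mul_sym)
      (simp add: matrix_mul_assoc[symmetric] matrix_inv_2[OF det(2)] CMM_matrix_def k)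
  have SLU: "U \<in> SL2_laurent" and SLV: "V \<in> SL2_laurent"
    unfolding U_def V_def using SL by (auto intro!: SL2_laurent_mult SL2_laurent_inv)
  have "X ** U ** Y = X ** Y ** Z ** (matrix_inv Y ** Y)" "Y ** V ** Z = (Y ** matrix_inv Y) ** X ** Y ** Z"
    unfolding U_def V_def by (simp_all only: matrix_mul_assoc)
  then have prods: "X ** U ** Y = T" "Y ** V ** Z = T"
    using XYZ by (simp_all add: matrix_inv_2[OF det(2)])
  have "(a, U $ 1 $ 2, b) \<in> nonlabeled_clusters k1 k2 k3"
    "(b, V $ 1 $ 2, c) \<in> nonlabeled_clusters k1 k2 k3"
    using ex(3,8) nonlabeled_cluster_swap23 unfolding U12 V12 k by blast+
  \<comment> \<open>The traces are those of \<open>Z\<close> and \<open>X\<close>; they fit the new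
    (1,2)-entries because exchange preserves parity.\<close>
  moreover have "CMM_matrix k1 k2 k3 U" "CMM_matrix k1 k2 k3 V"
    using SLU SLV trU trV ex(4,5,9,10) unfolding CMM_matrix_def U12 V12 k by simp_all
  ultimately have "CMM_triple k1 k2 k3 X U Y" "CMM_triple k1 k2 k3 Y V Z"
    using CMM prods by (simp_all add: CMM_triple_def abc T_def)
  with U12 V12 trU trV SLU SLV show ?thesis
    unfolding U_def V_def k by blast
qed

end
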